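(* Let $N\ge 2$, $\omega\in\mathbb{R}$, $\kappa>0$, $\tau>0$, and consider the unidirectional ring of delay-coupled phase oscillators $$\dot{x}_{j}(t)=\omega+\kappa\sin\left(x_{j+1}(t-\tau)-x_{j}(t)\right),\qquad j=1,\dots,N,\quad x_{N+1}:=x_1 .$$ Suppose $2\tau\kappa>\pi$. Then the system has at least $\frac{\kappa\tau}{\pi}-\frac12$ stable synchronous periodic solutions and at least $\frac{\kappa\tau}{\pi}-\frac12$ unstable synchronous periodic solutions.
   Context: The variables $x_j$ are phases, taken in $\mathbb{R}/2\pi\mathbb{Z}$, and indices are taken modulo $N$. A synchronous periodic solution is a solution of the form $x_j(t)=\Omega t$ for all $j$, with $\Omega\in\mathbb{R}$; it exists exactly when $\Omega=\omega-\kappa\sin(\Omega\tau)$. Synchronous solutions are counted by their frequencies $\Omega$. With $K=\kappa\cos(\Omega\tau)$, the characteristic exponents of such a solution are the numbers $\mu\in\mathbb{C}$ satisfying $\mu+K-Ke^{-\mu\tau}e^{2\pi i n/N}=0$ for some $n\in\{0,\dots,N-1\}$, equivalently the zeros of $F(\mu)=-(\mu+K)^N+K^Ne^{-N\mu\tau}$; $\mu=0$ is always a characteristic exponent (the trivial one). The solution is (linearly) stable if $\mu=0$ is a simple zero of $F$ and all other characteristic exponents have negative real part, and unstable if some characteristic exponent has positive real part.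
   Formalization: The number of unstable synchronous solutions is bounded below by the integer part of κτ/π − 1/2, since the bound as stated fails: for ω = 0, τ = 1, κ = 8/5 the only synchronous solution is Ω = 0, which is stable. *)

theory Defs
  imports "HOL-Complex_Analysis.Complex_Analysis"
begin

(* A solution is given by real lifts of the phases: x j t represents a class modulo 2*pi. The
   right-hand side is 2*pi-periodic in every phase, so it does not depend on the choice of lifts.
   The oscillators are labelled by the residues 0, ..., N - 1 modulo N. *)
definition ring_solution ::
  "nat \<Rightarrow> real \<Rightarrow> real \<Rightarrow> real \<Rightarrow> (nat \<Rightarrow> real \<Rightarrow> real) \<Rightarrow> bool" where
  "ring_solution N \<omega> \<kappa> \<tau> x \<longleftrightarrow>
     (\<forall>j<N. \<forall>t. (x j has_real_derivative
        \<omega> + \<kappa> * sin (x ((j + 1) mod N) (t - \<tau>) - x j t)) (at t))"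

definition synchronous_solution :: "nat \<Rightarrow> real \<Rightarrow> real \<Rightarrow> real \<Rightarrow> real \<Rightarrow> bool" where
  "synchronous_solution N \<omega> \<kappa> \<tau> \<Omega> \<longleftrightarrow> ring_solution N \<omega> \<kappa> \<tau> (\<lambda>j t. \<Omega> * t)"

definition coupling_slope :: "real \<Rightarrow> real \<Rightarrow> real \<Rightarrow> real" where
  "coupling_slope \<kappa> \<tau> \<Omega> = \<kappa> * cos (\<Omega> * \<tau>)"

definition characteristic_exponent ::
  "nat \<Rightarrow> real \<Rightarrow> real \<Rightarrow> real \<Rightarrow> complex \<Rightarrow> bool" where
  "characteristic_exponent N \<kappa> \<tau> \<Omega> \<mu> \<longleftrightarrow>
     (let K = complex_of_real (coupling_slope \<kappa> \<tau> \<Omega>)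
      in \<exists>n<N. \<mu> + K - K * exp (- \<mu> * of_real \<tau>)
                     * exp (2 * of_real pi * \<i> * of_nat n / of_nat N) = 0)"

definition characteristic_function ::
  "nat \<Rightarrow> real \<Rightarrow> real \<Rightarrow> real \<Rightarrow> complex \<Rightarrow> complex" where
  "characteristic_function N \<kappa> \<tau> \<Omega> \<mu> =
     (let K = complex_of_real (coupling_slope \<kappa> \<tau> \<Omega>)
      in - ((\<mu> + K) ^ N) + K ^ N * exp (- of_nat N * \<mu> * of_real \<tau>))"

(* The characteristic function is entire and, for N > 0, not identically zero, so zorder is the
   multiplicity of 0 as a zero of it. *)
definition stable_synchronous :: "nat \<Rightarrow> real \<Rightarrow> real \<Rightarrow> real \<Rightarrow> real \<Rightarrow> bool" where
  "stable_synchronous N \<omega> \<kappa> \<tau> \<Omega> \<longleftrightarrow>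
     synchronous_solution N \<omega> \<kappa> \<tau> \<Omega> \<and>
     zorder (characteristic_function N \<kappa> \<tau> \<Omega>) 0 = 1 \<and>
     (\<forall>\<mu>. characteristic_exponent N \<kappa> \<tau> \<Omega> \<mu> \<longrightarrow> \<mu> \<noteq> 0 \<longrightarrow> Re \<mu> < 0)"

definition unstable_synchronous :: "nat \<Rightarrow> real \<Rightarrow> real \<Rightarrow> real \<Rightarrow> real \<Rightarrow> bool" where
  "unstable_synchronous N \<omega> \<kappa> \<tau> \<Omega> \<longleftrightarrow>
     synchronous_solution N \<omega> \<kappa> \<tau> \<Omega> \<and>
     (\<exists>\<mu>. characteristic_exponent N \<kappa> \<tau> \<Omega> \<mu> \<and> Re \<mu> > 0)"

end

theory Submission
  imports Defs
begin

text \<open>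
  With \<open>\<theta> = \<Omega> \<tau>\<close>, synchronous solutions are the roots of
  \<open>\<theta> + \<kappa> \<tau> sin \<theta> = \<omega> \<tau>\<close>. If \<open>cos \<theta> > 0\<close>, comparing moduli in
  \<open>\<mu> + K = K exp (- \<mu> \<tau>) \<zeta>\<close> excludes \<open>Re \<mu> \<ge> 0\<close> except for \<open>\<mu> = 0\<close>.
  If \<open>cos \<theta> < 0\<close>, then with \<open>k = - K\<close> and any root of unity \<open>\<zeta> \<noteq> 1\<close> the map
  \<open>\<mu> \<mapsto> k - k exp (- \<mu> \<tau>) \<zeta>\<close> sends the disc \<open>\<bar>\<mu> - k\<bar> \<le> k\<close> into itself; a Brouwer fixed
  point is a nonzero characteristic exponent in that disc, so its real part is positive. The
  roots of each kind are found by the intermediate value theorem, one in each suitable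
  half period of the cosine.
\<close>

section \<open>Frequencies of synchronous solutions\<close>

lemma synchronous_solution_iff:
  assumes "N > 0"
  shows "synchronous_solution N \<omega> \<kappa> \<tau> \<Omega> \<longleftrightarrow> \<Omega> = \<omega> - \<kappa> * sin (\<Omega> * \<tau>)"
proof -
  have *: "((\<lambda>t. \<Omega> * t) has_real_derivative D) (at t) \<longleftrightarrow> D = \<Omega>" for D t
    using DERIV_unique DERIV_cmult_Id by blast
  have "\<Omega> * (t - \<tau>) - \<Omega> * t = - (\<Omega> * \<tau>)" for t
    by (simp add: algebra_simps)
  then show ?thesis
    using assms unfolding synchronous_solution_def ring_solution_def * by auto
qed

lemma synchronous_solution_phase:
  assumes "N > 0" "\<tau> > 0" "\<theta> + \<kappa> * \<tau> * sin \<theta> = \<omega> * \<tau>"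
  shows "synchronous_solution N \<omega> \<kappa> \<tau> (\<theta> / \<tau>)"
  using assms by (simp add: synchronous_solution_iff field_simps)

section \<open>Characteristic exponents: stability and instability\<close>

lemma cmod_root_of_unity:
  "cmod (exp (2 * of_real pi * \<i> * of_nat n / of_nat N)) = 1"
  by (simp add: norm_exp_eq_Re)

lemma characteristic_exponent_Re_neg:
  assumes "coupling_slope \<kappa> \<tau> \<Omega> > 0" "\<tau> \<ge> 0"
    and ce: "characteristic_exponent N \<kappa> \<tau> \<Omega> \<mu>" and "\<mu> \<noteq> 0"
  shows "Re \<mu> < 0"
proof (rule ccontr)
  assume "\<not> Re \<mu> < 0"
  then have nonneg: "Re \<mu> \<ge> 0" by simp
  define K where "K = coupling_slope \<kappa> \<tau> \<Omega>"
  have "K > 0" using assms(1) by (simp add: K_def)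
  obtain n where "\<mu> + of_real K =
      of_real K * exp (- \<mu> * of_real \<tau>) * exp (2 * of_real pi * \<i> * of_nat n / of_nat N)"
    using ce unfolding characteristic_exponent_def Let_def K_def[symmetric]
    by (metis (no_types, lifting) eq_iff_diff_eq_0)
  then have "cmod (\<mu> + of_real K) = K * exp (- Re \<mu> * \<tau>)"
    using \<open>K > 0\<close> by (simp only: norm_mult cmod_root_of_unity) (simp add: norm_exp_eq_Re)
  also have "\<dots> \<le> K"
    using nonneg \<open>K > 0\<close> \<open>\<tau> \<ge> 0\<close> by simp
  \<comment> \<open>The closed disc of radius \<open>K\<close> about \<open>- K\<close> meets the
    closed right half-plane only at 0: after squaring, the \<open>K\<close> squares cancel and every
    remaining term is nonnegative.\<close>
  finally have "(cmod (\<mu> + of_real K))\<^sup>2 \<le> K\<^sup>2"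
    by (simp add: power_mono)
  then have "(Re \<mu>)\<^sup>2 + 2 * Re \<mu> * K + (Im \<mu>)\<^sup>2 \<le> 0"
    by (simp add: cmod_power2 power2_sum)
  moreover have "Re \<mu> * K \<ge> 0"
    using nonneg \<open>K > 0\<close> by simp
  ultimately have "(Re \<mu>)\<^sup>2 + (Im \<mu>)\<^sup>2 \<le> 0" by linarith
  then have "\<mu> = 0"
    by (simp add: complex_eq_iff sum_power2_le_zero_iff)
  with \<open>\<mu> \<noteq> 0\<close> show False ..
qed

text \<open>The derivative at 0 is \<open>- N * K ^ (N - 1) * (1 + K * \<tau>)\<close>, and a
  positive slope keeps both \<open>K\<close> and \<open>1 + K * \<tau>\<close> away from
  zero.\<close>

lemma zorder_characteristic_function_0:
  assumes "coupling_slope \<kappa> \<tau> \<Omega> > 0" "\<tau> \<ge> 0" "N > 0"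
  shows "zorder (characteristic_function N \<kappa> \<tau> \<Omega>) 0 = 1"
proof -
  define K where "K = complex_of_real (coupling_slope \<kappa> \<tau> \<Omega>)"
  define F where "F = characteristic_function N \<kappa> \<tau> \<Omega>"
  have F: "F = (\<lambda>\<mu>. - ((\<mu> + K) ^ N) + K ^ N * exp (- of_nat N * \<mu> * of_real \<tau>))"
    unfolding F_def K_def characteristic_function_def Let_def ..
  have "(F has_field_derivative - of_nat N * K ^ (N - 1) * (1 + K * of_real \<tau>)) (at 0)"
    unfolding F
    by (rule derivative_eq_intros refl | simp)+
       (use \<open>N > 0\<close> in \<open>cases N; simp add: algebra_simps\<close>)
  then have "deriv F 0 = - of_nat N * K ^ (N - 1) * (1 + K * of_real \<tau>)"
    by (rule DERIV_imp_deriv)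
  moreover have "1 + K * of_real \<tau> = of_real (1 + coupling_slope \<kappa> \<tau> \<Omega> * \<tau>)"
    by (simp add: K_def)
  moreover have "1 + coupling_slope \<kappa> \<tau> \<Omega> * \<tau> > 0"
    using assms by (simp add: add_pos_nonneg)
  moreover have "K \<noteq> 0"
    using assms by (simp add: K_def)
  ultimately have "deriv F 0 \<noteq> 0"
    using \<open>N > 0\<close> by (simp del: of_real_add of_real_mult)
  moreover have "F holomorphic_on UNIV"
    unfolding F by (intro holomorphic_intros)
  moreover have "F 0 = 0"
    by (simp add: F)
  ultimately show ?thesis
    unfolding F_def[symmetric]
    by (intro zorder_zero_eqI[where S = UNIV]) auto
qed

lemma stable_synchronousI:
  assumes "synchronous_solution N \<omega> \<kappa> \<tau> \<Omega>" "coupling_slope \<kappa> \<tau> \<Omega> > 0" "\<tau> \<ge> 0" "N > 0"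
  shows "stable_synchronous N \<omega> \<kappa> \<tau> \<Omega>"
  using assms characteristic_exponent_Re_neg zorder_characteristic_function_0
  unfolding stable_synchronous_def by blast

text \<open>The disc touches the imaginary axis only at 0. This serves both to show that the disc is
  mapped into itself and to locate the fixed point.\<close>

lemma Re_pos_of_mem_disc:
  assumes "cmod (z - of_real k) \<le> k" "z \<noteq> 0"
  shows "Re z > 0"
proof -
  have "k \<ge> 0" using assms(1) norm_ge_zero order_trans by blast
  have "(cmod (z - of_real k))\<^sup>2 \<le> k\<^sup>2"
    using assms(1) by (simp add: power_mono)
  then have "(Re z)\<^sup>2 + (Im z)\<^sup>2 \<le> 2 * k * Re z"
    by (simp add: cmod_power2 power2_diff algebra_simps)
  moreover have "(Re z)\<^sup>2 + (Im z)\<^sup>2 > 0"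
    using \<open>z \<noteq> 0\<close> by (simp add: complex_eq_iff sum_power2_gt_zero_iff)
  ultimately have "k * Re z > 0" by linarith
  with \<open>k \<ge> 0\<close> show ?thesis
    by (simp add: zero_less_mult_iff)
qed

lemma delayed_root_Re_pos:
  fixes \<zeta> :: complex
  assumes "k > 0" "\<tau> \<ge> 0" "cmod \<zeta> = 1" "\<zeta> \<noteq> 1"
  obtains \<mu> where "\<mu> = of_real k - of_real k * exp (- \<mu> * of_real \<tau>) * \<zeta>" "Re \<mu> > 0"
proof -
  define f where "f \<mu> = of_real k - of_real k * exp (- \<mu> * of_real \<tau>) * \<zeta>" for \<mu>
  have "f \<mu> \<in> cball (of_real k) k" if "\<mu> \<in> cball (of_real k) k" for \<mu>
  proof -
    have "cmod (\<mu> - of_real k) \<le> k"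
      using that by (simp add: dist_norm norm_minus_commute)
    \<comment> \<open>On the disc the delay factor therefore has modulus at most 1.\<close>
    then have "Re \<mu> \<ge> 0"
      using Re_pos_of_mem_disc[of \<mu> k] by (cases "\<mu> = 0") auto
    then have "k * exp (- Re \<mu> * \<tau>) \<le> k"
      using assms by simp
    moreover have "dist (of_real k) (f \<mu>) = k * exp (- Re \<mu> * \<tau>)"
      using assms by (simp add: dist_norm f_def norm_mult norm_exp_eq_Re)
    ultimately show ?thesis by simp
  qed
  then have "f \<in> cball (of_real k) k \<rightarrow> cball (of_real k) k" by blast
  moreover have "continuous_on (cball (of_real k) k) f"
    unfolding f_def by (intro continuous_intros)
  ultimately obtain \<mu> where \<mu>: "\<mu> \<in> cball (of_real k) k" "f \<mu> = \<mu>"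
    using brouwer_ball[of k "of_real k" f] \<open>k > 0\<close> by blast
  \<comment> \<open>Here \<open>\<zeta> \<noteq> 1\<close> enters:
    \<open>f 0 = k * (1 - \<zeta>)\<close> is nonzero, so the fixed point is not the trivial
    exponent.\<close>
  have "\<mu> \<noteq> 0"
    using \<mu>(2) assms by (auto simp: f_def)
  moreover have "cmod (\<mu> - of_real k) \<le> k"
    using \<mu>(1) by (simp add: dist_norm norm_minus_commute)
  ultimately have "Re \<mu> > 0"
    by (rule Re_pos_of_mem_disc[rotated])
  with \<mu>(2) show ?thesis
    using that unfolding f_def by metis
qed

lemma unstable_synchronousI:
  assumes "synchronous_solution N \<omega> \<kappa> \<tau> \<Omega>" "coupling_slope \<kappa> \<tau> \<Omega> < 0" "\<tau> \<ge> 0" "N \<ge> 2"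
  shows "unstable_synchronous N \<omega> \<kappa> \<tau> \<Omega>"
proof -
  define K where "K = coupling_slope \<kappa> \<tau> \<Omega>"
  \<comment> \<open>The mode \<open>n = 1\<close> is available and nontrivial exactly because
    \<open>N \<ge> 2\<close>.\<close>
  define \<zeta> where "\<zeta> = exp (2 * of_real pi * \<i> * of_nat 1 / of_nat N)"
  have "\<zeta> \<noteq> 1"
    using complex_root_unity_eq_1[of N 1] \<open>N \<ge> 2\<close> by (simp add: \<zeta>_def)
  moreover have "cmod \<zeta> = 1"
    unfolding \<zeta>_def by (rule cmod_root_of_unity)
  moreover have "- K > 0"
    using assms(2) by (simp add: K_def)
  ultimately obtain \<mu> where \<mu>:
    "\<mu> = of_real (- K) - of_real (- K) * exp (- \<mu> * of_real \<tau>) * \<zeta>" "Re \<mu> > 0"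
    using delayed_root_Re_pos \<open>\<tau> \<ge> 0\<close> by blast
  have "\<mu> + of_real K - of_real K * exp (- \<mu> * of_real \<tau>) * \<zeta> = 0"
    by (subst (1) \<mu>(1)) simp
  then have "characteristic_exponent N \<kappa> \<tau> \<Omega> \<mu>"
    unfolding characteristic_exponent_def Let_def K_def \<zeta>_def
    using \<open>N \<ge> 2\<close> by (intro exI[of _ 1]) auto
  with \<mu>(2) assms(1) show ?thesis
    unfolding unstable_synchronous_def by blast
qed

section \<open>Roots of the phase equation and their number\<close>

lemma phase_root_increasing_branch:
  assumes "a \<ge> 0" "\<bar>c - 2 * pi * of_int m\<bar> < a + pi / 2"
  obtains \<theta> where "2 * pi * of_int m - pi / 2 < \<theta>" "\<theta> < 2 * pi * of_int m + pi / 2"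
    "\<theta> + a * sin \<theta> = c"
proof -
  define x where "x = 2 * pi * real_of_int m"
  have s: "sin (x + y) = sin y" for y
    by (simp add: x_def sin_add)
  have "\<exists>\<theta>. x - pi / 2 \<le> \<theta> \<and> \<theta> \<le> x + pi / 2 \<and> \<theta> + a * sin \<theta> = c"
    using assms(2) s[of "pi / 2"] s[of "- (pi / 2)"] unfolding x_def[symmetric]
    by (intro IVT') (auto intro!: continuous_intros)
  then obtain \<theta> where \<theta>: "x - pi / 2 \<le> \<theta>" "\<theta> \<le> x + pi / 2" "\<theta> + a * sin \<theta> = c"
    by blast
  \<comment> \<open>The cosine vanishes at the endpoints, so they must be excluded to get a positive
    slope; the strict bound on \<open>c\<close> does this.\<close>
  moreover have "\<theta> \<noteq> x - pi / 2" "\<theta> \<noteq> x + pi / 2"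
    using \<theta>(3) assms(2) s[of "pi / 2"] s[of "- (pi / 2)"] unfolding x_def[symmetric] by auto
  ultimately show ?thesis
    using that unfolding x_def by force
qed

text \<open>
  The endpoint cases of the second assumption are included because \<open>\<theta> + a sin \<theta>\<close> has derivative
  \<open>1\<close> at both ends of the branch. Without them the count of unstable solutions would be one
  short of \<open>\<lfloor>\<kappa> \<tau> / \<pi> - 1 / 2\<rfloor>\<close> for some \<open>\<omega>\<close>.
\<close>
lemma phase_root_decreasing_branch:
  assumes "a > pi / 2" "\<bar>c - 2 * pi * of_int m - pi\<bar> \<le> a - pi / 2"
  obtains \<theta> where "2 * pi * of_int m + pi / 2 < \<theta>" "\<theta> < 2 * pi * of_int m + 3 * pi / 2"
    "\<theta> + a * sin \<theta> = c"
proof -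
  define x where "x = 2 * pi * real_of_int m"
  define l r where "l = x + pi / 2" and "r = x + (pi + pi / 2)"
  define g where "g \<theta> = \<theta> + a * sin \<theta>" for \<theta>
  have s: "sin (x + y) = sin y" and co: "cos (x + y) = cos y" for y
    by (simp_all add: x_def sin_add cos_add)
  have der: "(g has_real_derivative 1 + a * cos \<theta>) (at \<theta>)" for \<theta>
    unfolding g_def by (auto intro!: derivative_eq_intros)
  have "cos l = 0" "cos r = 0" "sin l = 1" "sin r = - 1"
    unfolding l_def r_def s co unfolding sin_add cos_add by simp_all
  then have der1: "(g has_real_derivative 1) (at l)" "(g has_real_derivative 1) (at r)"
    and gl: "g l \<ge> c" and gr: "g r \<le> c"
    using der[of l] der[of r] assms(2)
    unfolding x_def[symmetric] by (auto simp: g_def l_def r_def)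
  have "l < r" by (simp add: l_def r_def)
  obtain d where d: "d > 0" "\<And>h. 0 < h \<Longrightarrow> h < d \<Longrightarrow> g l < g (l + h)"
    using DERIV_pos_inc_right[OF der1(1)] by auto
  obtain e where e: "e > 0" "\<And>h. 0 < h \<Longrightarrow> h < e \<Longrightarrow> g (r - h) < g r"
    using DERIV_pos_inc_left[OF der1(2)] by auto
  \<comment> \<open>Moving both ends inward by \<open>h\<close> makes the inequalities strict:
    \<open>g (l + h) > c > g (r - h)\<close>. The divisor 3 keeps \<open>h\<close> strictly below
    \<open>d\<close> and \<open>e\<close> and the shrunken interval nonempty.\<close>
  define h where "h = min (min d e) (r - l) / 3"
  have h: "0 < h" "h < d" "h < e" "l + h \<le> r - h"
    using d(1) e(1) \<open>l < r\<close> unfolding h_def by (auto simp: min_def field_simps)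
  have "\<exists>\<theta>. l + h \<le> \<theta> \<and> \<theta> \<le> r - h \<and> g \<theta> = c"
    using d(2)[of h] e(2)[of h] h gl gr
    by (intro IVT2') (auto simp: g_def intro!: continuous_intros)
  then obtain \<theta> where \<theta>: "l + h \<le> \<theta>" "\<theta> \<le> r - h" "g \<theta> = c" by blast
  show ?thesis
    by (rule that[of \<theta>]) (use \<theta> h(1) in \<open>auto simp: l_def r_def x_def g_def\<close>)
qed

text \<open>Witnesses with different labels under \<open>f\<close> are distinct, so counting labels
  bounds the number of solutions from below.\<close>

lemma exists_finite_of_fibres:
  assumes "finite M" "\<And>m. m \<in> M \<Longrightarrow> \<exists>x. P x \<and> f x = m"
  shows "\<exists>A. finite A \<and> (\<forall>x\<in>A. P x) \<and> card A = card M"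
proof -
  obtain g where g: "\<And>m. m \<in> M \<Longrightarrow> P (g m) \<and> f (g m) = m"
    using assms(2) by metis
  then have "inj_on g M"
    by (intro inj_on_inverseI[of _ f]) auto
  then show ?thesis
    using g assms(1) by (intro exI[of _ "g ` M"]) (auto simp: card_image)
qed

text \<open>Both branches of index \<open>m\<close> lie in this period, so one label serves the
  stable and the unstable count.\<close>

lemma floor_phase_eq:
  assumes "2 * pi * of_int m - pi / 2 < \<theta>" "\<theta> < 2 * pi * of_int m + 3 * pi / 2"
  shows "\<lfloor>(\<theta> + pi / 2) / (2 * pi)\<rfloor> = m"
  using assms by (intro floor_unique) (auto simp: field_simps)

text \<open>The unstable count is bounded by a floor because the unrounded bound can fail: for
  \<open>\<omega> = 0\<close> and \<open>\<kappa> * \<tau> = 1.6\<close> the only phase root is 0,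
  which is stable, while \<open>1.6 / pi - 1 / 2 > 0\<close>.\<close>

theorem lemma2:
  fixes N :: nat and \<omega> \<kappa> \<tau> :: real
  assumes "N \<ge> 2" and "\<kappa> > 0" and "\<tau> > 0" and "2 * \<tau> * \<kappa> > pi"
  shows "(\<exists>A. finite A \<and> (\<forall>\<Omega>\<in>A. stable_synchronous N \<omega> \<kappa> \<tau> \<Omega>)
             \<and> real (card A) \<ge> \<kappa> * \<tau> / pi - 1 / 2)
       \<and> (\<exists>B. finite B \<and> (\<forall>\<Omega>\<in>B. unstable_synchronous N \<omega> \<kappa> \<tau> \<Omega>)
             \<and> int (card B) \<ge> \<lfloor>\<kappa> * \<tau> / pi - 1 / 2\<rfloor>)"
proof
  define a c where "a = \<kappa> * \<tau>" and "c = \<omega> * \<tau>"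
  define f where "f \<Omega> = \<lfloor>(\<Omega> * \<tau> + pi / 2) / (2 * pi)\<rfloor>" for \<Omega>
  have "a > pi / 2" using assms(4) by (simp add: a_def mult_ac)
  have "a > 0" using \<open>a > pi / 2\<close> pi_gt_zero by linarith
  have "N > 0" using \<open>N \<ge> 2\<close> by simp
  have shift: "cos (\<theta> - 2 * pi * of_int m) = cos \<theta>" for \<theta> m
    by (simp add: cos_diff)

  \<comment> \<open>Solving the hypothesis of the increasing branch for \<open>m\<close> gives
    \<open>u < m < v\<close>; \<open>M\<close> collects these integers.\<close>
  define u v where "u = c / (2 * pi) - a / (2 * pi) - 1 / 4"
    and "v = c / (2 * pi) + a / (2 * pi) + 1 / 4"
  define M where "M = {\<lfloor>u\<rfloor> + 1..\<lceil>v\<rceil> - 1}"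
  have "\<exists>\<Omega>. stable_synchronous N \<omega> \<kappa> \<tau> \<Omega> \<and> f \<Omega> = m" if "m \<in> M" for m
  proof -
    have "u < m" "m < v"
      using that unfolding M_def by (auto simp: floor_less_iff less_ceiling_iff) linarith+
    then have "\<bar>c - 2 * pi * of_int m\<bar> < a + pi / 2"
      unfolding u_def v_def abs_less_iff by (auto simp: field_simps)
    then obtain \<theta> where \<theta>: "2 * pi * of_int m - pi / 2 < \<theta>" "\<theta> < 2 * pi * of_int m + pi / 2"
      "\<theta> + a * sin \<theta> = c"
      using phase_root_increasing_branch \<open>a > 0\<close> by (metis less_imp_le)
    have "cos (\<theta> - 2 * pi * of_int m) > 0"
      using \<theta>(1,2) by (intro cos_gt_zero_pi) auto
    then have "coupling_slope \<kappa> \<tau> (\<theta> / \<tau>) > 0"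
      unfolding shift using assms by (simp add: coupling_slope_def)
    moreover have "synchronous_solution N \<omega> \<kappa> \<tau> (\<theta> / \<tau>)"
      using \<theta>(3) assms by (intro synchronous_solution_phase) (auto simp: a_def c_def)
    moreover have "f (\<theta> / \<tau>) = m"
      using \<theta>(1,2) assms floor_phase_eq[of m \<theta>] by (simp add: f_def)
    ultimately show ?thesis
      using stable_synchronousI \<open>N > 0\<close> \<open>\<tau> > 0\<close> by (metis less_imp_le)
  qed
  then obtain A where A: "finite A" "\<forall>\<Omega>\<in>A. stable_synchronous N \<omega> \<kappa> \<tau> \<Omega>" "card A = card M"
    using exists_finite_of_fibres[of M _ f] unfolding M_def by (metis finite_atLeastAtMost_int)
  have "v - u - 1 = a / pi - 1 / 2"
    unfolding u_def v_def by (simp add: field_simps)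
  \<comment> \<open>An open interval of length d contains at least d - 1 integers; here d is
    \<open>a / pi + 1 / 2\<close>.\<close>
  moreover have "real (card M) \<ge> v - u - 1"
    unfolding M_def by simp linarith
  ultimately show "\<exists>A. finite A \<and> (\<forall>\<Omega>\<in>A. stable_synchronous N \<omega> \<kappa> \<tau> \<Omega>)
             \<and> real (card A) \<ge> \<kappa> * \<tau> / pi - 1 / 2"
    using A by (auto simp: a_def)

  \<comment> \<open>Likewise, the decreasing branch requires
    \<open>p \<le> m \<le> q\<close>.\<close>
  define p q where "p = c / (2 * pi) - a / (2 * pi) - 1 / 4"
    and "q = c / (2 * pi) + a / (2 * pi) - 3 / 4"
  define L where "L = {\<lceil>p\<rceil>..\<lfloor>q\<rfloor>}"
  have "\<exists>\<Omega>. unstable_synchronous N \<omega> \<kappa> \<tau> \<Omega> \<and> f \<Omega> = m" if "m \<in> L" for m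
  proof -
    have "p \<le> m" "m \<le> q"
      using that unfolding L_def by (auto simp: ceiling_le_iff le_floor_iff)
    then have "\<bar>c - 2 * pi * of_int m - pi\<bar> \<le> a - pi / 2"
      unfolding p_def q_def abs_le_iff by (auto simp: field_simps)
    then obtain \<theta> where \<theta>: "2 * pi * of_int m + pi / 2 < \<theta>" "\<theta> < 2 * pi * of_int m + 3 * pi / 2"
      "\<theta> + a * sin \<theta> = c"
      using phase_root_decreasing_branch \<open>a > pi / 2\<close> by metis
    have "cos (\<theta> - 2 * pi * of_int m - pi) > 0"
      using \<theta>(1,2) by (intro cos_gt_zero_pi) auto
    then have "cos (\<theta> - 2 * pi * of_int m) < 0"
      by (simp add: cos_diff[of _ pi])
    then have "coupling_slope \<kappa> \<tau> (\<theta> / \<tau>) < 0"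
      unfolding shift using assms by (simp add: coupling_slope_def mult_pos_neg)
    moreover have "synchronous_solution N \<omega> \<kappa> \<tau> (\<theta> / \<tau>)"
      using \<theta>(3) assms by (intro synchronous_solution_phase) (auto simp: a_def c_def)
    moreover have "f (\<theta> / \<tau>) = m"
      using \<theta>(1,2) assms pi_gt_zero floor_phase_eq[of m \<theta>] by (simp add: f_def)
    ultimately show ?thesis
      using unstable_synchronousI assms by (metis less_imp_le)
  qed
  then obtain B where B: "finite B" "\<forall>\<Omega>\<in>B. unstable_synchronous N \<omega> \<kappa> \<tau> \<Omega>" "card B = card L"
    using exists_finite_of_fibres[of L _ f] unfolding L_def by (metis finite_atLeastAtMost_int)
  have "q - p = a / pi - 1 / 2"
    unfolding p_def q_def by (simp add: field_simps)
  \<comment> \<open>A closed interval of length d contains at least floor(d) integers; an open one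
    with integer ends would have one fewer.\<close>
  moreover have "int (card L) \<ge> \<lfloor>q - p\<rfloor>"
    unfolding L_def by simp linarith
  ultimately show "\<exists>B. finite B \<and> (\<forall>\<Omega>\<in>B. unstable_synchronous N \<omega> \<kappa> \<tau> \<Omega>)
             \<and> int (card B) \<ge> \<lfloor>\<kappa> * \<tau> / pi - 1 / 2\<rfloor>"
    using B by (auto simp: a_def)
qed

end
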